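(* Let $f_1,\dots,f_K:\mathbb{R}^d\to\mathbb{R}$ be differentiable, let $f:\mathbb{R}^d\to\mathbb{R}$ be $L$-smooth with minimum value $f^*$, and suppose that for every $\boldsymbol{x}\in\mathbb{R}^d$, with $k\sim\mathrm{Unif}([K])$, one has $\mathbb{E}[f_k(\boldsymbol{x})]=f(\boldsymbol{x})$, $\mathbb{E}[\nabla f_k(\boldsymbol{x})]=\nabla f(\boldsymbol{x})$ and $\mathbb{E}\big[\|\nabla f_k(\boldsymbol{x})\|^2\big]\le\lambda^2$, where $\lambda\geq 0$ is a constant. Let $T\ge1$ be an integer, let $\Sigma_1,\dots,\Sigma_T\in\mathbb{R}^{d\times d}$ be symmetric and invertible, put $\Sigma_0=0$, let $\eta_1,\dots,\eta_T>0$, let $\boldsymbol{x}_0\in\mathbb{R}^d$, let $k_1,\dots,k_T$ be independent with $k_t\sim\mathrm{Unif}([K])$, and define $$\boldsymbol{x}_t=\boldsymbol{x}_{t-1}-\eta_t\nabla f_{k_t,\Sigma_t}(\boldsymbol{x}_{t-1}),\qquad t=1,\dots,T.$$ Let $B$ be any real-valued function of pairs of matrices, each of which is either $0$ or a symmetric invertible $d\times d$ matrix, such that $|f_{\Sigma}(\boldsymbol{x})-f_{S}(\boldsymbol{x})|\le B(\Sigma,S)$ for all such $\Sigma,S$ and all $\boldsymbol{x}\in\mathbb{R}^d$. Then for some $\nu\in\{0,1,\dots,T-1\}$, $$\mathbb{E}\big[\|\nabla f_{\Sigma_{\nu+1}}(\boldsymbol{x}_\nu)\|^2\big]\le\fr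ac{f(\boldsymbol{x}_0)-f^*}{\sum_{t=1}^{T}\eta_t}+\frac{L\lambda^2\sum_{t=1}^{T}\eta_t^2}{\sum_{t=1}^{T}\eta_t}+\frac{L^3(3+d)^3}{8}\,\frac{\sum_{t=1}^{T}\|\Sigma_t\|^4\|\Sigma_t^{-1}\|^2\eta_t^2}{\sum_{t=1}^{T}\eta_t}+\frac{\sum_{t=1}^{T}B(\Sigma_t,\Sigma_{t-1})}{\sum_{t=1}^{T}\eta_t}.$$
   Context: $[K]=\{1,\dots,K\}$ and $\mathrm{Unif}([K])$ is the uniform distribution on it. A function is $L$-smooth if it is differentiable with $L$-Lipschitz gradient (Euclidean norm). For a function $g:\mathbb{R}^d\to\mathbb{R}$ and a symmetric invertible matrix $\Sigma\in\mathbb{R}^{d\times d}$ (and also for $\Sigma=0$, in which case $g_0=g$), the $\Sigma$-Gaussian smoothing of $g$ is $$g_\Sigma(\boldsymbol{x})=\frac{1}{\pi^{d/2}}\int_{\mathbb{R}^d}g(\boldsymbol{x}+\Sigma\boldsymbol{u})e^{-\|\boldsymbol{u}\|^2}\,d\boldsymbol{u};$$ $f_{k,\Sigma}$ denotes the $\Sigma$-Gaussian smoothing of $f_k$. For vectors $\|\cdot\|$ is the Euclidean norm; for matrices $\|\Sigma\|=\max_{\|\boldsymbol{x}\|\le1}\|\Sigma\boldsymbol{x}\|$. The iteration is the AGS-SGD algorithm (anisotropic Gaussian smoothing stochastic gradient descent) with learning rates $\eta_t$. *)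

theory Defs
  imports "HOL-Probability.Probability"
begin

definition grad :: "('a::real_inner \<Rightarrow> real) \<Rightarrow> 'a \<Rightarrow> 'a" where
  "grad g x = (THE D. GDERIV g x :> D)"

definition L_smooth :: "real \<Rightarrow> ('a::real_inner \<Rightarrow> real) \<Rightarrow> bool" where
  "L_smooth L g \<longleftrightarrow> (\<forall>x. g differentiable (at x)) \<and> L-lipschitz_on UNIV (grad g)"

(* For S = 0 this is g itself, since the integral of exp (-|u|^2) over R^d is pi^(d/2). *)
definition gauss_smooth ::
    "real ^ 'n ^ 'n \<Rightarrow> (real ^ 'n \<Rightarrow> real) \<Rightarrow> real ^ 'n \<Rightarrow> real" where
  "gauss_smooth S g x =
     1 / pi powr (real CARD('n) / 2) * (LINT u|lborel. g (x + S *v u) * exp (- (norm u)\<^sup>2))"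

definition sym_invertible :: "real ^ 'n ^ 'n \<Rightarrow> bool" where
  "sym_invertible S \<longleftrightarrow> transpose S = S \<and> invertible S"

definition mat_norm :: "real ^ 'n ^ 'n \<Rightarrow> real" where
  "mat_norm S = onorm (\<lambda>x. S *v x)"

(* The trajectory for a fixed realisation k of the sampled indices;
   k, S and eta are only used at indices t \<ge> 1. *)
primrec ags_sgd ::
    "(nat \<Rightarrow> real ^ 'n \<Rightarrow> real) \<Rightarrow> (nat \<Rightarrow> real ^ 'n ^ 'n) \<Rightarrow> (nat \<Rightarrow> real) \<Rightarrow> real ^ 'n
      \<Rightarrow> (nat \<Rightarrow> nat) \<Rightarrow> nat \<Rightarrow> real ^ 'n" where
  "ags_sgd fs S eta x0 k 0 = x0"
| "ags_sgd fs S eta x0 k (Suc t) =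
     ags_sgd fs S eta x0 k t
       - eta (Suc t) *\<^sub>R grad (gauss_smooth (S (Suc t)) (fs (k (Suc t)))) (ags_sgd fs S eta x0 k t)"

end

theory Submission
  imports Defs
begin

text \<open>
  Gaussian smoothing replaces \<open>g x\<close> by the mean of \<open>g (x + S u)\<close> over a Gaussian vector \<open>u\<close>. Since
  the second moments of the gradients of the \<open>f\<^sub>j\<close> are bounded by \<open>\<lambda>\<^sup>2\<close> and there are only \<open>K\<close> of
  them, each of these gradients is bounded, so each \<open>f\<^sub>j\<close> is Lipschitz and one may differentiate under
  the integral: the gradient of the smoothed function is the mean of the shifted gradients
  (\<open>GDERIV_expectation_shift\<close>). Averaging over the shift therefore preserves everything the analysis
  of SGD uses: the smoothed \<open>f\<close> still satisfies the descent inequality with the same constant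
  (\<open>gauss_smooth_descent\<close>), the smoothed stochastic gradients are still unbiased
  (\<open>unbiased_gauss_smooth\<close>), and by Jensen's inequality their second moment is still at most \<open>\<lambda>\<^sup>2\<close>
  (\<open>grad_bound_gauss_smooth\<close>).

  Write \<open>F\<^sub>t\<close> for \<open>f\<close> smoothed by \<open>\<Sigma>\<^sub>t\<close>. The index used in step \<open>t\<close> is independent of
  \<open>x\<^bsub>t-1\<^esub>\<close>, so its expectation may be taken first (\<open>expectation_next_index\<close>), and one step gives
  \<open>E F\<^sub>t(x\<^sub>t) \<le> E F\<^sub>t(x\<^bsub>t-1\<^esub>) - \<eta>\<^sub>t E |\<nabla>F\<^sub>t(x\<^bsub>t-1\<^esub>)|\<^sup>2 + L \<eta>\<^sub>t\<^sup>2 \<lambda>\<^sup>2 / 2\<close>.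
  Exchanging \<open>F\<^sub>t\<close> for \<open>F\<^bsub>t-1\<^esub>\<close> on the right costs at most \<open>B(\<Sigma>\<^sub>t, \<Sigma>\<^bsub>t-1\<^esub>)\<close>, after which the
  inequalities telescope from \<open>F\<^sub>0(x\<^sub>0) = f(x\<^sub>0)\<close> to \<open>F\<^sub>T(x\<^sub>T) \<ge> f\<^sup>*\<close>. The result bounds the
  \<open>\<eta>\<close>-weighted mean of the squared gradient norms, and some term is at most the mean. The
  smoothed stochastic gradients are controlled by \<open>\<lambda>\<^sup>2\<close> directly, so the summand with the factor
  \<open>(3 + d)\<^sup>3\<close> enters only through its nonnegativity.
\<close>

section \<open>Gradients\<close>

lemma grad_eqI:
  assumes "GDERIV g x :> D"
  shows "grad g x = D"
  unfolding grad_def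
proof (rule the_equality)
  show "GDERIV g x :> D" by (rule assms)
  fix D' assume "GDERIV g x :> D'"
  then have "(\<lambda>h. h \<bullet> D') = (\<lambda>h. h \<bullet> D)"
    using assms has_derivative_unique unfolding gderiv_def by blast
  then show "D' = D"
    using vector_eq_ldot[of D' D] by (simp add: fun_eq_iff)
qed

lemma GDERIV_grad:
  fixes g :: "'a::euclidean_space \<Rightarrow> real"
  assumes "g differentiable (at x)"
  shows "GDERIV g x :> grad g x"
proof -
  obtain g' where g': "(g has_derivative g') (at x)"
    using assms by (auto simp: differentiable_def)
  interpret g': bounded_linear g'
    using g' by (rule has_derivative_bounded_linear)
  define D where "D = (\<Sum>b\<in>Basis. g' b *\<^sub>R b)"
  have "g' = (\<lambda>h. h \<bullet> D)"
  proof (rule ext)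
    fix h
    have "g' h = g' (\<Sum>b\<in>Basis. (h \<bullet> b) *\<^sub>R b)"
      by (simp add: euclidean_representation)
    also have "\<dots> = h \<bullet> D"
      by (simp add: D_def g'.sum g'.scaleR inner_sum_right mult.commute)
    finally show "g' h = h \<bullet> D" .
  qed
  then have D: "GDERIV g x :> D"
    using g' by (simp add: gderiv_def)
  with grad_eqI[OF this] show ?thesis
    by simp
qed

lemma lipschitz_of_bounded_grad:
  fixes g :: "'a::euclidean_space \<Rightarrow> real"
  assumes diff: "\<And>x. g differentiable (at x)" and bound: "\<And>x. norm (grad g x) \<le> C"
  shows "\<bar>g y - g x\<bar> \<le> C * norm (y - x)"
proof -
  have "norm (g y - g x) \<le> C * norm (y - x)"
  proof (rule differentiable_bound[where S=UNIV and f'="\<lambda>x h. h \<bullet> grad g x"])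
    show "(g has_derivative (\<lambda>h. h \<bullet> grad g z)) (at z)" for z
      using GDERIV_grad[OF diff] by (simp add: gderiv_def)
    show "onorm (\<lambda>h. h \<bullet> grad g z) \<le> C" for z
    proof (rule onorm_le)
      fix h :: 'a
      have "norm (h \<bullet> grad g z) \<le> norm h * norm (grad g z)"
        by (simp add: Cauchy_Schwarz_ineq2)
      also have "\<dots> \<le> C * norm h"
        using mult_left_mono[OF bound[of z], of "norm h"] by (simp add: mult.commute)
      finally show "norm (h \<bullet> grad g z) \<le> C * norm h" .
    qed
  qed auto
  then show ?thesis by simp
qed

lemma borel_measurable_of_differentiable:
  fixes g :: "'a::euclidean_space \<Rightarrow> real"
  assumes diff: "\<And>x. g differentiable (at x)"
  shows "g \<in> borel_measurable borel"
  by (intro borel_measurable_continuous_onI continuous_at_imp_continuous_on ballI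
      differentiable_imp_continuous_within diff)

text \<open>
  The gradient need not be continuous, but each of its coordinates is a pointwise limit of difference
  quotients of a continuous function.
\<close>
lemma borel_measurable_grad:
  fixes g :: "'a::euclidean_space \<Rightarrow> real"
  assumes diff: "\<And>x. g differentiable (at x)"
  shows "grad g \<in> borel_measurable borel"
proof (subst borel_measurable_euclidean_space, intro ballI)
  fix b :: 'a assume "b \<in> Basis"
  note [measurable] = borel_measurable_of_differentiable[OF diff]
  show "(\<lambda>x. grad g x \<bullet> b) \<in> borel_measurable borel"
  proof (rule borel_measurable_LIMSEQ_real)
    show "(\<lambda>x. (g (x + (1 / real (Suc n)) *\<^sub>R b) - g x) / (1 / real (Suc n)))
        \<in> borel_measurable borel" for n
      by measurable
    fix x :: 'a
    have "((\<lambda>s. x + s *\<^sub>R b) has_derivative (\<lambda>s. s *\<^sub>R b)) (at 0)"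
      by (auto intro!: derivative_eq_intros)
    moreover have "(g has_derivative (\<lambda>h. h \<bullet> grad g x)) (at (x + 0 *\<^sub>R b))"
      using GDERIV_grad[OF diff, of x] by (simp add: gderiv_def)
    ultimately have "((\<lambda>s. g (x + s *\<^sub>R b)) has_derivative (\<lambda>s. (s *\<^sub>R b) \<bullet> grad g x)) (at 0)"
      by (rule has_derivative_compose)
    then have "DERIV (\<lambda>s. g (x + s *\<^sub>R b)) 0 :> grad g x \<bullet> b"
      by (simp add: has_field_derivative_def inner_commute mult_commute_abs)
    then have "(\<lambda>s. (g (x + s *\<^sub>R b) - g x) / s) \<midarrow>0\<rightarrow> grad g x \<bullet> b"
      by (simp add: DERIV_def)
    moreover have "filterlim (\<lambda>n. 1 / real (Suc n)) (at 0) sequentially"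
      using LIMSEQ_Suc[OF lim_1_over_n] by (auto simp: filterlim_at)
    ultimately show "(\<lambda>n. (g (x + (1 / real (Suc n)) *\<^sub>R b) - g x) / (1 / real (Suc n)))
        \<longlonglongrightarrow> grad g x \<bullet> b"
      by (rule filterlim_compose)
  qed
qed

lemma L_smooth_differentiable: "L_smooth L f \<Longrightarrow> f differentiable (at x)"
  by (simp add: L_smooth_def)

lemma L_smooth_nonneg: "L_smooth L f \<Longrightarrow> L \<ge> 0"
  by (auto simp: L_smooth_def dest: lipschitz_on_nonneg)

text \<open>
  Along the segment from \<open>x\<close> to \<open>y\<close> the difference of the two sides has derivative of one sign,
  because the gradient moves by at most \<open>L s |y - x|\<close> up to parameter \<open>s\<close>.
\<close>
lemma L_smooth_descent:
  fixes f :: "'a::euclidean_space \<Rightarrow> real"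
  assumes "L_smooth L f"
  shows "f y \<le> f x + (y - x) \<bullet> grad f x + L / 2 * (norm (y - x))\<^sup>2"
proof -
  define h where "h = y - x"
  define p where "p s = f (x + s *\<^sub>R h) - s * (h \<bullet> grad f x) - L / 2 * s\<^sup>2 * (norm h)\<^sup>2" for s
  note diff = L_smooth_differentiable[OF assms]
  have lip: "norm (grad f z - grad f w) \<le> L * norm (z - w)" for z w
    using assms by (auto simp: L_smooth_def dist_norm dest: lipschitz_onD)
  have "p 1 \<le> p 0"
  proof (rule DERIV_nonpos_imp_nonincreasing[where f=p])
    fix s :: real assume s: "0 \<le> s" "s \<le> 1"
    have "((\<lambda>s. x + s *\<^sub>R h) has_derivative (\<lambda>s. s *\<^sub>R h)) (at s)"
      by (auto intro!: derivative_eq_intros)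
    moreover have "(f has_derivative (\<lambda>u. u \<bullet> grad f (x + s *\<^sub>R h))) (at (x + s *\<^sub>R h))"
      using GDERIV_grad[OF diff] by (simp add: gderiv_def)
    ultimately have "((\<lambda>s. f (x + s *\<^sub>R h)) has_derivative
        (\<lambda>r. (r *\<^sub>R h) \<bullet> grad f (x + s *\<^sub>R h))) (at s)"
      by (rule has_derivative_compose)
    then have "DERIV (\<lambda>s. f (x + s *\<^sub>R h)) s :> h \<bullet> grad f (x + s *\<^sub>R h)"
      by (simp add: has_field_derivative_def mult_commute_abs)
    then have "DERIV p s :> h \<bullet> grad f (x + s *\<^sub>R h) - h \<bullet> grad f x - L * s * (norm h)\<^sup>2"
      unfolding p_def by (auto intro!: derivative_eq_intros)
    moreover have "h \<bullet> grad f (x + s *\<^sub>R h) - h \<bullet> grad f x \<le> L * s * (norm h)\<^sup>2"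
    proof -
      have "h \<bullet> grad f (x + s *\<^sub>R h) - h \<bullet> grad f x \<le> norm h * norm (grad f (x + s *\<^sub>R h) - grad f x)"
        by (simp add: norm_cauchy_schwarz flip: inner_diff_right)
      also have "\<dots> \<le> norm h * (L * norm (s *\<^sub>R h))"
        using lip[of "x + s *\<^sub>R h" x] by (intro mult_left_mono) auto
      also have "\<dots> = L * s * (norm h)\<^sup>2"
        using s by (simp add: power2_eq_square)
      finally show ?thesis .
    qed
    ultimately show "\<exists>d. DERIV p s :> d \<and> d \<le> 0"
      by force
  qed simp
  then show ?thesis
    by (simp add: p_def h_def)
qed

section \<open>Averaging over a random shift\<close>

context prob_space
begin

text \<open>
  Jensen's inequality for the squared norm of a vector: the norm goes inside the expectation first, and
  the variance of the resulting real variable is nonnegative.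
\<close>
lemma norm_expectation_sq_le:
  fixes X :: "'a \<Rightarrow> 'b::{banach, second_countable_topology}"
  assumes X: "X \<in> borel_measurable M" and bound: "\<And>\<omega>. norm (X \<omega>) \<le> C"
  shows "(norm (expectation X))\<^sup>2 \<le> expectation (\<lambda>\<omega>. (norm (X \<omega>))\<^sup>2)"
proof -
  note X[measurable]
  have [simp]: "integrable M (\<lambda>\<omega>. norm (X \<omega>))"
    using bound by (intro integrable_const_bound[where B=C]) auto
  have [simp]: "integrable M (\<lambda>\<omega>. (norm (X \<omega>))\<^sup>2)"
    using bound by (intro integrable_const_bound[where B="C\<^sup>2"]) (auto intro!: power_mono AE_I2)
  have "(norm (expectation X))\<^sup>2 \<le> (expectation (\<lambda>\<omega>. norm (X \<omega>)))\<^sup>2"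
    by (intro power_mono integral_norm_bound) auto
  also have "\<dots> \<le> expectation (\<lambda>\<omega>. (norm (X \<omega>))\<^sup>2)"
    using variance_positive[of "\<lambda>\<omega>. norm (X \<omega>)"] by (simp add: variance_eq)
  finally show ?thesis .
qed

context
  fixes g :: "'b::euclidean_space \<Rightarrow> real" and W :: "'a \<Rightarrow> 'b" and C :: real
  assumes diff: "\<And>x. g differentiable (at x)"
    and bound: "\<And>x. norm (grad g x) \<le> C"
    and W: "integrable M W"
begin

text \<open>
  A bounded gradient makes \<open>g\<close> Lipschitz, so \<open>g\<close> grows at most linearly and a first moment of the shift
  suffices.
\<close>
lemma integrable_shift: "integrable M (\<lambda>\<omega>. g (x + W \<omega>))"
proof (rule Bochner_Integration.integrable_bound)
  note [measurable] = borel_measurable_of_differentiable[OF diff] borel_measurable_integrable[OF W]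
  show "integrable M (\<lambda>\<omega>. \<bar>g x\<bar> + C * norm (W \<omega>))"
    using W by simp
  show "(\<lambda>\<omega>. g (x + W \<omega>)) \<in> borel_measurable M"
    by measurable
  have "\<bar>g (x + W \<omega>)\<bar> \<le> \<bar>g x\<bar> + C * norm (W \<omega>)" for \<omega>
    using lipschitz_of_bounded_grad[OF diff bound, of "x + W \<omega>" x] by simp
  then show "AE \<omega> in M. norm (g (x + W \<omega>)) \<le> norm (\<bar>g x\<bar> + C * norm (W \<omega>))"
    by (intro AE_I2) (smt (verit) real_norm_def)
qed

lemma integrable_grad_shift: "integrable M (\<lambda>\<omega>. grad g (x + W \<omega>))"
proof (rule integrable_const_bound[where B=C])
  note [measurable] = borel_measurable_grad[OF diff] borel_measurable_integrable[OF W]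
  show "(\<lambda>\<omega>. grad g (x + W \<omega>)) \<in> borel_measurable M"
    by measurable
qed (simp add: bound)

text \<open>
  The normalised remainder \<open>q h\<close> of the linear approximation tends to \<open>0\<close> pointwise and is bounded by
  \<open>2 C\<close>: once \<open>C\<close> for the increment, by the Lipschitz property, and once for the linear part. Dominated
  convergence then applies on the probability space.
\<close>
lemma GDERIV_expectation_shift:
  "GDERIV (\<lambda>x. expectation (\<lambda>\<omega>. g (x + W \<omega>))) x :> expectation (\<lambda>\<omega>. grad g (x + W \<omega>))"
  unfolding gderiv_def has_derivative_at
proof (intro conjI)
  note [measurable] = borel_measurable_grad[OF diff] borel_measurable_of_differentiable[OF diff]
    borel_measurable_integrable[OF W]
  note [simp] = integrable_shift integrable_grad_shift
  define D where "D = expectation (\<lambda>\<omega>. grad g (x + W \<omega>))"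
  define q where "q h \<omega> = (g (x + h + W \<omega>) - g (x + W \<omega>) - h \<bullet> grad g (x + W \<omega>)) / norm h" for h \<omega>
  show "bounded_linear (\<lambda>h. h \<bullet> D)"
    by (rule bounded_linear_inner_left)
  have q_eq: "expectation (q h) = (expectation (\<lambda>\<omega>. g (x + h + W \<omega>))
      - expectation (\<lambda>\<omega>. g (x + W \<omega>)) - h \<bullet> D) / norm h" for h
    by (simp add: q_def[abs_def] D_def)
  have q_bound: "norm (q h \<omega>) \<le> 2 * C" for h \<omega>
  proof (cases "h = 0")
    case True
    then show ?thesis
      using order_trans[OF norm_ge_zero bound] by (simp add: q_def)
  next
    case False
    have "\<bar>g (x + h + W \<omega>) - g (x + W \<omega>)\<bar> \<le> C * norm h"
      using lipschitz_of_bounded_grad[OF diff bound, of "x + h + W \<omega>" "x + W \<omega>"] by simp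
    moreover have "\<bar>h \<bullet> grad g (x + W \<omega>)\<bar> \<le> C * norm h"
      using Cauchy_Schwarz_ineq2[of h "grad g (x + W \<omega>)"]
        mult_left_mono[OF bound[of "x + W \<omega>"], of "norm h"] by (simp add: mult.commute)
    ultimately have "\<bar>g (x + h + W \<omega>) - g (x + W \<omega>) - h \<bullet> grad g (x + W \<omega>)\<bar> \<le> 2 * C * norm h"
      by linarith
    then show ?thesis
      using False by (simp add: q_def pos_divide_le_eq)
  qed
  have q_lim: "(\<lambda>h. q h \<omega>) \<midarrow>0\<rightarrow> 0" for \<omega>
  proof -
    have "(g has_derivative (\<lambda>h. h \<bullet> grad g (x + W \<omega>))) (at (x + W \<omega>))"
      using GDERIV_grad[OF diff] by (simp add: gderiv_def)
    then have "(\<lambda>h. norm (g (x + W \<omega> + h) - g (x + W \<omega>) - h \<bullet> grad g (x + W \<omega>)) / norm h) \<midarrow>0\<rightarrow> 0"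
      by (simp add: has_derivative_at)
    then have "(\<lambda>h. norm (q h \<omega>)) \<midarrow>0\<rightarrow> 0"
      by (simp add: q_def add_ac)
    then show ?thesis
      by (rule tendsto_norm_zero_cancel)
  qed
  have "(\<lambda>h. expectation (q h)) \<midarrow>0\<rightarrow> 0"
    unfolding tendsto_at_iff_sequentially comp_def
  proof (intro allI impI)
    fix X :: "nat \<Rightarrow> 'b" assume X: "\<forall>i. X i \<in> UNIV - {0}" "X \<longlonglongrightarrow> 0"
    have "(\<lambda>n. expectation (q (X n))) \<longlonglongrightarrow> expectation (\<lambda>\<omega>. 0)"
    proof (rule integral_dominated_convergence[where w="\<lambda>_. 2 * C"])
      show "AE \<omega> in M. (\<lambda>n. q (X n) \<omega>) \<longlonglongrightarrow> 0"
        using q_lim X unfolding tendsto_at_iff_sequentially comp_def by auto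
      show "q (X n) \<in> borel_measurable M" for n
        unfolding q_def[abs_def] by measurable
    qed (use q_bound in auto)
    then show "(\<lambda>n. expectation (q (X n))) \<longlonglongrightarrow> 0"
      by simp
  qed
  then have "(\<lambda>h. norm (expectation (q h))) \<midarrow>0\<rightarrow> 0"
    by (rule tendsto_norm_zero)
  then show "(\<lambda>h. norm (expectation (\<lambda>\<omega>. g (x + h + W \<omega>)) - expectation (\<lambda>\<omega>. g (x + W \<omega>)) - h \<bullet> D)
      / norm h) \<midarrow>0\<rightarrow> 0"
    by (simp add: q_eq)
qed

end

end

section \<open>The Gaussian weight\<close>

text \<open>
  The case \<open>\<sigma>\<^sup>2 = 1/2\<close> is the normalisation of the smoothing weight; the case \<open>\<sigma> = 1\<close> supplies an
  integrable majorant for its first moment.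
\<close>
lemma nn_integral_gaussian:
  assumes "\<sigma> > 0"
  shows "(\<integral>\<^sup>+u. exp (- (norm (u::'a::euclidean_space))\<^sup>2 / (2 * \<sigma>\<^sup>2)) \<partial>lborel)
    = (2 * pi * \<sigma>\<^sup>2) powr (real DIM('a) / 2)"
proof -
  let ?c = "(2 * pi * \<sigma>\<^sup>2) powr (real DIM('a) / 2)"
  have c: "?c > 0"
    using assms by simp
  have sq: "sqrt (2 * pi * \<sigma>\<^sup>2) ^ DIM('a) = ?c"
  proof -
    have "sqrt (2 * pi * \<sigma>\<^sup>2) ^ DIM('a) = sqrt (2 * pi * \<sigma>\<^sup>2) powr real DIM('a)"
      using assms by (intro powr_realpow[symmetric]) simp
    also have "\<dots> = ((2 * pi * \<sigma>\<^sup>2) powr (1 / 2)) powr real DIM('a)"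
      using assms by (subst powr_half_sqrt) auto
    also have "\<dots> = ?c"
      by (simp only: powr_powr) simp
    finally show ?thesis .
  qed
  have "(\<Prod>b\<in>Basis. normal_density 0 \<sigma> (u \<bullet> b)) = exp (- (norm u)\<^sup>2 / (2 * \<sigma>\<^sup>2)) / ?c" for u :: 'a
    unfolding normal_density_def prod.distrib prod_dividef prod_constant sq
      exp_sum[OF finite_Basis, symmetric] power2_norm_eq_inner euclidean_inner[of u u]
    by (simp add: sum_divide_distrib sum_negf power2_eq_square)
  then have "exp (- (norm u)\<^sup>2 / (2 * \<sigma>\<^sup>2)) = ?c * (\<Prod>b\<in>Basis. normal_density 0 \<sigma> (u \<bullet> b))" for u :: 'a
    using c by simp
  then have "(\<integral>\<^sup>+u. exp (- (norm (u::'a))\<^sup>2 / (2 * \<sigma>\<^sup>2)) \<partial>lborel)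
      = (\<integral>\<^sup>+u. ennreal ?c * (\<Prod>b\<in>Basis. ennreal (normal_density 0 \<sigma> ((u::'a) \<bullet> b))) \<partial>lborel)"
    using c by (simp add: ennreal_mult prod_nonneg prod_ennreal)
  also have "\<dots> = ennreal ?c * (\<Prod>b\<in>(Basis::'a set). \<integral>\<^sup>+x. ennreal (normal_density 0 \<sigma> x) \<partial>lborel)"
    by (subst nn_integral_cmult, measurable) (subst nn_integral_lborel_prod, auto)
  also have "(\<integral>\<^sup>+x. ennreal (normal_density 0 \<sigma> x) \<partial>lborel) = 1"
    using assms by (subst nn_integral_eq_integral) auto
  finally show ?thesis by simp
qed

text \<open>The law of a centred normal vector with covariance matrix \<open>I / 2\<close>.\<close>
definition gauss_measure :: "'a::euclidean_space measure" where
  "gauss_measure = density lborel (\<lambda>u. ennreal (exp (- (norm u)\<^sup>2) / pi powr (real DIM('a) / 2)))"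

lemma sets_gauss_measure [measurable_cong, simp]: "sets gauss_measure = sets borel"
  by (simp add: gauss_measure_def)

lemma prob_space_gauss_measure: "prob_space (gauss_measure :: 'a::euclidean_space measure)"
proof
  let ?c = "pi powr (real DIM('a) / 2)"
  have "emeasure gauss_measure (space (gauss_measure :: 'a measure)) =
      (\<integral>\<^sup>+u. ennreal (exp (- (norm (u::'a))\<^sup>2) / ?c) \<partial>lborel)"
    by (simp add: gauss_measure_def emeasure_density)
  also have "\<dots> = (\<integral>\<^sup>+u. ennreal (1 / ?c) * ennreal (exp (- (norm (u::'a))\<^sup>2)) \<partial>lborel)"
    by (simp flip: ennreal_mult)
  also have "\<dots> = ennreal (1 / ?c) * (\<integral>\<^sup>+u. ennreal (exp (- (norm (u::'a))\<^sup>2)) \<partial>lborel)"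
    by (rule nn_integral_cmult) measurable
  also have "(\<integral>\<^sup>+u. ennreal (exp (- (norm (u::'a))\<^sup>2)) \<partial>lborel) = ?c"
    using nn_integral_gaussian[of "1 / sqrt 2", where 'a='a] by (simp add: power_divide)
  finally show "emeasure gauss_measure (space (gauss_measure :: 'a measure)) = 1"
    by (simp flip: ennreal_mult)
qed

text \<open>The factor \<open>|u|\<close> is absorbed by half of the exponent: \<open>|u| \<le> exp (|u|\<^sup>2 / 2)\<close>.\<close>
lemma integrable_gauss_measure_id: "integrable (gauss_measure :: 'a::euclidean_space measure) (\<lambda>u. u)"
  unfolding gauss_measure_def
proof (subst integrable_density)
  let ?c = "pi powr (real DIM('a) / 2)"
  show "integrable lborel (\<lambda>u::'a. (exp (- (norm u)\<^sup>2) / ?c) *\<^sub>R u)"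
  proof (rule Bochner_Integration.integrable_bound)
    have "integrable lborel (\<lambda>u::'a. exp (- (norm u)\<^sup>2 / 2))"
      using nn_integral_gaussian[of 1, where 'a='a] by (intro integrableI_nonneg) auto
    then show "integrable lborel (\<lambda>u::'a. exp (- (norm u)\<^sup>2 / 2) / ?c)"
      by simp
    show "AE u::'a in lborel. norm ((exp (- (norm u)\<^sup>2) / ?c) *\<^sub>R u) \<le> norm (exp (- (norm u)\<^sup>2 / 2) / ?c)"
    proof (rule AE_I2)
      fix u :: 'a
      have "norm u \<le> 1 + (norm u)\<^sup>2 / 2"
        using zero_le_power2[of "norm u - 1"] by (simp add: power2_eq_square algebra_simps)
      also have "\<dots> \<le> exp ((norm u)\<^sup>2 / 2)"
        by (rule exp_ge_add_one_self)
      finally have "exp (- (norm u)\<^sup>2) * norm u \<le> exp (- (norm u)\<^sup>2) * exp ((norm u)\<^sup>2 / 2)"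
        by simp
      also have "\<dots> = exp (- (norm u)\<^sup>2 / 2)"
        by (simp flip: exp_add)
      finally show "norm ((exp (- (norm u)\<^sup>2) / ?c) *\<^sub>R u) \<le> norm (exp (- (norm u)\<^sup>2 / 2) / ?c)"
        by (simp add: divide_right_mono)
    qed
  qed measurable
qed auto

lemma gauss_smooth_eq_expectation:
  fixes S :: "real ^ 'n ^ 'n"
  assumes g: "g \<in> borel_measurable borel"
  shows "gauss_smooth S g x = (LINT u|gauss_measure. g (x + S *v u))"
proof -
  have [measurable]: "(\<lambda>u. S *v u) \<in> borel_measurable borel"
    by (intro borel_measurable_continuous_onI continuous_intros matrix_vector_mult_linear_continuous_on)
  note g[measurable]
  let ?c = "pi powr (real CARD('n) / 2)"
  have "(LINT u|gauss_measure. g (x + S *v u))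
      = (LINT u|lborel. (exp (- (norm u)\<^sup>2) / ?c) *\<^sub>R g (x + S *v u))"
    unfolding gauss_measure_def by (subst integral_density) auto
  also have "\<dots> = (LINT u|lborel. (1 / ?c) * (g (x + S *v u) * exp (- (norm u)\<^sup>2)))"
    by (simp add: mult.commute)
  also have "\<dots> = gauss_smooth S g x"
    unfolding gauss_smooth_def by (rule integral_mult_right_zero)
  finally show ?thesis by simp
qed

lemma integrable_gauss_linear:
  fixes S :: "real ^ 'n ^ 'm"
  shows "integrable gauss_measure (\<lambda>u. S *v u)"
  using integrable_bounded_linear[OF matrix_vector_mul_bounded_linear integrable_gauss_measure_id] .

context
  fixes S :: "real ^ 'n ^ 'n" and g :: "real ^ 'n \<Rightarrow> real" and C :: real
  assumes diff: "\<And>x. g differentiable (at x)"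
    and bound: "\<And>x. norm (grad g x) \<le> C"
begin

lemma integrable_gauss_shift: "integrable gauss_measure (\<lambda>u. g (x + S *v u))"
  by (intro prob_space.integrable_shift[OF prob_space_gauss_measure diff bound] integrable_gauss_linear)

lemma integrable_gauss_grad_shift: "integrable gauss_measure (\<lambda>u. grad g (x + S *v u))"
  by (intro prob_space.integrable_grad_shift[OF prob_space_gauss_measure diff bound]
      integrable_gauss_linear)

lemma gauss_smooth_eq: "gauss_smooth S g x = (LINT u|gauss_measure. g (x + S *v u))"
  by (intro gauss_smooth_eq_expectation borel_measurable_of_differentiable diff)

lemma grad_gauss_smooth: "grad (gauss_smooth S g) x = (LINT u|gauss_measure. grad g (x + S *v u))"
proof -
  have "gauss_smooth S g = (\<lambda>x. LINT u|gauss_measure. g (x + S *v u))"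
    using gauss_smooth_eq by blast
  then show ?thesis
    using prob_space.GDERIV_expectation_shift[OF prob_space_gauss_measure diff bound
        integrable_gauss_linear[of S]]
    by (simp add: grad_eqI)
qed

lemma norm_grad_gauss_smooth_sq_le:
  "(norm (grad (gauss_smooth S g) x))\<^sup>2 \<le> (LINT u|gauss_measure. (norm (grad g (x + S *v u)))\<^sup>2)"
  unfolding grad_gauss_smooth
  by (intro prob_space.norm_expectation_sq_le[OF prob_space_gauss_measure _ bound]
      borel_measurable_integrable integrable_gauss_grad_shift)

lemma integrable_norm_grad_shift_sq:
  "integrable gauss_measure (\<lambda>u. (norm (grad g (x + S *v u)))\<^sup>2)"
proof -
  interpret prob_space "gauss_measure :: (real ^ 'n) measure"
    by (rule prob_space_gauss_measure)
  have [measurable]: "(\<lambda>u. grad g (x + S *v u)) \<in> borel_measurable gauss_measure"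
    by (intro borel_measurable_integrable integrable_gauss_grad_shift)
  show ?thesis
    using bound by (intro integrable_const_bound[where B="C\<^sup>2"]) (auto intro!: AE_I2 power_mono)
qed

lemma gauss_smooth_lower_bound:
  assumes "\<And>x. c \<le> g x"
  shows "c \<le> gauss_smooth S g x"
proof -
  interpret prob_space "gauss_measure :: (real ^ 'n) measure"
    by (rule prob_space_gauss_measure)
  show ?thesis
    unfolding gauss_smooth_eq using assms integrable_gauss_shift by (intro integral_ge_const) auto
qed

text \<open>
  The descent inequality of \<open>g\<close> at the shifted points \<open>x + S u\<close> and \<open>y + S u\<close> involves the same
  displacement \<open>y - x\<close> for every \<open>u\<close>, so it can be averaged with its constant unchanged.
\<close>
lemma gauss_smooth_descent:
  assumes "L_smooth L g"
  shows "gauss_smooth S g y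
    \<le> gauss_smooth S g x + (y - x) \<bullet> grad (gauss_smooth S g) x + L / 2 * (norm (y - x))\<^sup>2"
proof -
  interpret prob_space "gauss_measure :: (real ^ 'n) measure"
    by (rule prob_space_gauss_measure)
  note [simp] = integrable_gauss_shift integrable_gauss_grad_shift
  have "gauss_smooth S g y \<le> (LINT u|gauss_measure.
      g (x + S *v u) + (y - x) \<bullet> grad g (x + S *v u) + L / 2 * (norm (y - x))\<^sup>2)"
    unfolding gauss_smooth_eq
  proof (rule integral_mono)
    fix u
    show "g (y + S *v u) \<le> g (x + S *v u) + (y - x) \<bullet> grad g (x + S *v u) + L / 2 * (norm (y - x))\<^sup>2"
      using L_smooth_descent[OF assms, of "y + S *v u" "x + S *v u"] by simp
  qed auto
  then show ?thesis
    by (simp add: gauss_smooth_eq grad_gauss_smooth prob_space)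
qed

end

lemma gauss_smooth_zero:
  assumes "\<And>x. g differentiable (at x)"
  shows "gauss_smooth 0 g x = g x"
proof -
  interpret prob_space "gauss_measure :: (real ^ 'n) measure"
    by (rule prob_space_gauss_measure)
  show ?thesis
    using gauss_smooth_eq_expectation[OF borel_measurable_of_differentiable[OF assms], of 0 x]
    by (simp add: prob_space)
qed

section \<open>One step from a fixed point\<close>

text \<open>
  Expectations over a uniform index are written as sums over \<open>{1..K}\<close>, with the factor \<open>K\<close> on the other
  side.
\<close>

context
  fixes K :: nat and fs :: "nat \<Rightarrow> real ^ 'n \<Rightarrow> real" and f :: "real ^ 'n \<Rightarrow> real" and L lam :: real
  assumes K: "K \<ge> 1"
    and fs_diff: "\<And>j x. j \<in> {1..K} \<Longrightarrow> fs j differentiable (at x)"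
    and f_smooth: "L_smooth L f"
    and unbiased: "\<And>x. (\<Sum>j=1..K. grad (fs j) x) = real K *\<^sub>R grad f x"
    and grad_bound: "\<And>x. (\<Sum>j=1..K. (norm (grad (fs j) x))\<^sup>2) \<le> real K * lam\<^sup>2"
begin

text \<open>
  One summand of the second moment is at most the whole sum. Only the existence of a bound matters here:
  it makes the results on smoothing applicable, and its size does not enter the final estimate.
\<close>
lemma norm_grad_component_le:
  assumes "j \<in> {1..K}"
  shows "norm (grad (fs j) x) \<le> sqrt (real K * lam\<^sup>2)"
proof (rule real_le_rsqrt)
  have "(norm (grad (fs j) x))\<^sup>2 \<le> (\<Sum>j=1..K. (norm (grad (fs j) x))\<^sup>2)"
    using assms by (intro member_le_sum) auto
  then show "(norm (grad (fs j) x))\<^sup>2 \<le> real K * lam\<^sup>2"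
    using grad_bound[of x] by simp
qed

lemma norm_grad_mean_le: "norm (grad f x) \<le> sqrt (real K * lam\<^sup>2)"
proof -
  have "real K * norm (grad f x) = norm (\<Sum>j=1..K. grad (fs j) x)"
    by (simp add: unbiased del: One_nat_def)
  also have "\<dots> \<le> (\<Sum>j=1..K. sqrt (real K * lam\<^sup>2))"
    by (intro sum_norm_le norm_grad_component_le)
  finally show ?thesis
    using K by simp
qed

lemma unbiased_gauss_smooth:
  "(\<Sum>j=1..K. grad (gauss_smooth S (fs j)) x) = real K *\<^sub>R grad (gauss_smooth S f) x"
proof -
  have "(\<Sum>j=1..K. grad (gauss_smooth S (fs j)) x)
      = (\<Sum>j=1..K. LINT u|gauss_measure. grad (fs j) (x + S *v u))"
    by (intro sum.cong refl grad_gauss_smooth[OF fs_diff norm_grad_component_le])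
  also have "\<dots> = (LINT u|gauss_measure. (\<Sum>j=1..K. grad (fs j) (x + S *v u)))"
    by (intro Bochner_Integration.integral_sum[symmetric]
        integrable_gauss_grad_shift[OF fs_diff norm_grad_component_le])
  also have "\<dots> = real K *\<^sub>R grad (gauss_smooth S f) x"
    by (simp add: unbiased grad_gauss_smooth[OF L_smooth_differentiable[OF f_smooth] norm_grad_mean_le] del: One_nat_def)
  finally show ?thesis .
qed

text \<open>
  Jensen's inequality is applied to each summand, after which the hypothesis holds under the integral at
  every shifted point. Bounding each component separately would lose a factor \<open>K\<close>.
\<close>
lemma grad_bound_gauss_smooth:
  "(\<Sum>j=1..K. (norm (grad (gauss_smooth S (fs j)) x))\<^sup>2) \<le> real K * lam\<^sup>2"
proof -
  interpret prob_space "gauss_measure :: (real ^ 'n) measure"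
    by (rule prob_space_gauss_measure)
  note int = integrable_norm_grad_shift_sq[OF fs_diff norm_grad_component_le]
  have "(\<Sum>j=1..K. (norm (grad (gauss_smooth S (fs j)) x))\<^sup>2)
      \<le> (\<Sum>j=1..K. LINT u|gauss_measure. (norm (grad (fs j) (x + S *v u)))\<^sup>2)"
    by (intro sum_mono norm_grad_gauss_smooth_sq_le[OF fs_diff norm_grad_component_le])
  also have "\<dots> = (LINT u|gauss_measure. (\<Sum>j=1..K. (norm (grad (fs j) (x + S *v u)))\<^sup>2))"
    by (intro Bochner_Integration.integral_sum[symmetric] int)
  also have "\<dots> \<le> real K * lam\<^sup>2"
    by (intro integral_le_const Bochner_Integration.integrable_sum int AE_I2 grad_bound)
  finally show ?thesis .
qed

text \<open>
  The descent inequality is averaged over the step directions: its linear term sees only their mean, the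
  gradient of the smoothed \<open>f\<close>, and its quadratic term only their second moment.
\<close>
lemma mean_step_le:
  "(\<Sum>j=1..K. gauss_smooth S f (x - \<eta> *\<^sub>R grad (gauss_smooth S (fs j)) x)) / K
    \<le> gauss_smooth S f x - \<eta> * (norm (grad (gauss_smooth S f) x))\<^sup>2 + L / 2 * \<eta>\<^sup>2 * lam\<^sup>2"
proof -
  define G where "G = grad (gauss_smooth S f) x"
  define g where "g j = grad (gauss_smooth S (fs j)) x" for j
  note L = L_smooth_nonneg[OF f_smooth]
  have "(\<Sum>j=1..K. gauss_smooth S f (x - \<eta> *\<^sub>R g j))
      \<le> (\<Sum>j=1..K. gauss_smooth S f x - \<eta> * (g j \<bullet> G) + L / 2 * \<eta>\<^sup>2 * (norm (g j))\<^sup>2)"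
  proof (rule sum_mono)
    fix j
    show "gauss_smooth S f (x - \<eta> *\<^sub>R g j)
        \<le> gauss_smooth S f x - \<eta> * (g j \<bullet> G) + L / 2 * \<eta>\<^sup>2 * (norm (g j))\<^sup>2"
      using gauss_smooth_descent[OF L_smooth_differentiable[OF f_smooth] norm_grad_mean_le f_smooth, of S "x - \<eta> *\<^sub>R g j" x]
      by (simp add: G_def power_mult_distrib)
  qed
  also have "\<dots> = K * gauss_smooth S f x - \<eta> * ((\<Sum>j=1..K. g j) \<bullet> G)
      + L / 2 * \<eta>\<^sup>2 * (\<Sum>j=1..K. (norm (g j))\<^sup>2)"
    by (simp add: sum.distrib sum_subtractf inner_sum_left sum_distrib_left)
  also have "(\<Sum>j=1..K. g j) \<bullet> G = K * (norm G)\<^sup>2"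
    by (simp add: g_def G_def unbiased_gauss_smooth power2_norm_eq_inner del: One_nat_def)
  also have "L / 2 * \<eta>\<^sup>2 * (\<Sum>j=1..K. (norm (g j))\<^sup>2) \<le> L / 2 * \<eta>\<^sup>2 * (K * lam\<^sup>2)"
    unfolding g_def using L by (intro mult_left_mono grad_bound_gauss_smooth) simp
  finally have "(\<Sum>j=1..K. gauss_smooth S f (x - \<eta> *\<^sub>R g j))
      \<le> (gauss_smooth S f x - \<eta> * (norm G)\<^sup>2 + L / 2 * \<eta>\<^sup>2 * lam\<^sup>2) * K"
    by (simp add: algebra_simps)
  then show ?thesis
    using K by (simp add: pos_divide_le_eq G_def g_def)
qed

end

section \<open>Independent uniform indices\<close>

text \<open>
  The position after \<open>t\<close> steps is determined by the first \<open>t\<close> indices; this is what makes it independent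
  of the next one.
\<close>
lemma ags_sgd_cong:
  assumes "\<And>i. i \<in> {1..t} \<Longrightarrow> k i = k' i"
  shows "ags_sgd fs S eta x0 k t = ags_sgd fs S eta x0 k' t"
  using assms by (induction t) auto

context prob_space
begin

text \<open>
  A function of finitely many indices, each with finitely many values, takes only finitely many values
  almost surely. It is measurable for any \<open>F\<close>, since a finite power of a countable discrete space is
  discrete; hence no regularity of the trajectory in the indices has to be discussed.
\<close>
lemma integrable_finite_history:
  fixes k :: "'i \<Rightarrow> 'a \<Rightarrow> 'k::countable" and F :: "('i \<Rightarrow> 'k) \<Rightarrow> real"
  assumes I: "finite I" and A: "finite A"
    and k: "\<And>i. i \<in> I \<Longrightarrow> random_variable (count_space UNIV) (k i)"
    and range: "\<And>i. i \<in> I \<Longrightarrow> AE \<omega> in M. k i \<omega> \<in> A"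
    and F: "\<And>s. F (restrict s I) = F s"
  shows "integrable M (\<lambda>\<omega>. F (\<lambda>i. k i \<omega>))"
proof (rule integrable_const_bound)
  let ?B = "Max ((\<lambda>s. \<bar>F s\<bar>) ` (I \<rightarrow>\<^sub>E A))"
  have "AE \<omega> in M. \<forall>i\<in>I. k i \<omega> \<in> A"
    using I range by (simp add: AE_finite_all)
  then show "AE \<omega> in M. norm (F (\<lambda>i. k i \<omega>)) \<le> ?B"
  proof (rule AE_mp, intro AE_I2 impI)
    fix \<omega> assume "\<forall>i\<in>I. k i \<omega> \<in> A"
    then have "\<bar>F (restrict (\<lambda>i. k i \<omega>) I)\<bar> \<le> ?B"
      using I A by (intro Max_ge imageI finite_imageI finite_PiE) auto
    then show "norm (F (\<lambda>i. k i \<omega>)) \<le> ?B"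
      by (simp add: F)
  qed
  have "(\<lambda>\<omega>. restrict (\<lambda>i. k i \<omega>) I) \<in> measurable M (PiM I (\<lambda>_. count_space UNIV))"
    using k by (rule measurable_restrict)
  moreover have "F \<in> borel_measurable (PiM I (\<lambda>_. count_space UNIV))"
    using I by (subst count_space_PiM_finite) auto
  ultimately have "(\<lambda>\<omega>. F (restrict (\<lambda>i. k i \<omega>) I)) \<in> borel_measurable M"
    by (rule measurable_compose)
  then show "(\<lambda>\<omega>. F (\<lambda>i. k i \<omega>)) \<in> borel_measurable M"
    by (simp add: F)
qed

context
  fixes k :: "nat \<Rightarrow> 'a \<Rightarrow> nat" and K T :: nat
  assumes K: "K \<ge> 1"
    and indep: "indep_vars (\<lambda>_. count_space UNIV) k {1..T}"
    and unif: "\<And>t. t \<in> {1..T} \<Longrightarrow>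
      distr M (count_space UNIV) (k t) = measure_pmf (pmf_of_set {1..K})"
begin

lemma index_measurable: "t \<in> {1..T} \<Longrightarrow> random_variable (count_space UNIV) (k t)"
  using indep by (simp add: indep_vars_def)

lemma AE_index_in_range:
  assumes "t \<in> {1..T}"
  shows "AE \<omega> in M. k t \<omega> \<in> {1..K}"
proof -
  have "AE j in distr M (count_space UNIV) (k t). j \<in> {1..K}"
    unfolding unif[OF assms] using K by (simp add: AE_measure_pmf_iff)
  then show ?thesis
    using index_measurable[OF assms] by (simp add: AE_distr_iff)
qed

lemma prob_index_eq:
  assumes "t \<in> {1..T}" "j \<in> {1..K}"
  shows "expectation (\<lambda>\<omega>. indicator {j} (k t \<omega>)) = 1 / K"
proof -
  have "expectation (\<lambda>\<omega>. indicator {j} (k t \<omega>))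
      = (LINT i|distr M (count_space UNIV) (k t). indicator {j} i :: real)"
    using index_measurable[OF assms(1)] by (subst integral_distr) auto
  also have "\<dots> = 1 / K"
    unfolding unif[OF assms(1)] using assms(2) K
    by (simp add: integral_pmf_of_set sum.delta indicator_def)
  finally show ?thesis .
qed

lemma integrable_history:
  assumes "t \<le> T" and "\<And>s. F (restrict s {1..t}) = F s"
  shows "integrable M (\<lambda>\<omega>. F (\<lambda>i. k i \<omega>) :: real)"
proof (rule integrable_finite_history)
  show "random_variable (count_space UNIV) (k i)" "AE \<omega> in M. k i \<omega> \<in> {1..K}" if "i \<in> {1..t}" for i
    using that assms(1) index_measurable[of i] AE_index_in_range[of i] by simp_all
  show "F (restrict s {1..t}) = F s" for s
    by (rule assms(2))
qed simp_all

text \<open>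
  This replaces conditioning on the past. Splitting according to the value \<open>j\<close> of the next index gives a
  finite sum of products of a function of the past and the indicator of \<open>j\<close>; these factors are independent,
  and the indicator has expectation \<open>1 / K\<close>.
\<close>
lemma expectation_next_index:
  assumes t: "t < T" and H: "\<And>s j. H (restrict s {1..t}) j = (H s j :: real)"
  shows "expectation (\<lambda>\<omega>. H (\<lambda>i. k i \<omega>) (k (Suc t) \<omega>))
    = expectation (\<lambda>\<omega>. (\<Sum>j=1..K. H (\<lambda>i. k i \<omega>) j) / K)"
proof -
  let ?I = "{1..t}" and ?J = "{Suc t}"
  let ?P = "\<lambda>I. PiM I (\<lambda>_::nat. count_space (UNIV :: nat set))"
  define Z where "Z j \<omega> = H (\<lambda>i. k i \<omega>) j" for j \<omega>
  define Y where "Y j \<omega> = (indicator {j} (k (Suc t) \<omega>) :: real)" for j \<omega>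
  have Z_int: "integrable M (Z j)" for j
    unfolding Z_def using t H[of _ j] by (rule integrable_history[OF less_imp_le])
  have Y_int: "integrable M (Y j)" for j
  proof (rule integrable_const_bound[where B=1])
    have "random_variable (count_space UNIV) (k (Suc t))"
      using t by (intro index_measurable) simp
    then show "Y j \<in> borel_measurable M"
      unfolding Y_def by (rule measurable_compose) simp
  qed (simp add: Y_def indicator_def)
  have ind: "indep_var borel (Z j) borel (Y j)" for j
  proof -
    have "indep_var (?P ?I) (\<lambda>\<omega>. restrict (\<lambda>i. k i \<omega>) ?I) (?P ?J) (\<lambda>\<omega>. restrict (\<lambda>i. k i \<omega>) ?J)"
      using t by (intro indep_var_restrict[OF indep]) auto
    then have "indep_var borel ((\<lambda>s. H s j) \<circ> (\<lambda>\<omega>. restrict (\<lambda>i. k i \<omega>) ?I))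
        borel ((\<lambda>s. indicator {j} (s (Suc t)) :: real) \<circ> (\<lambda>\<omega>. restrict (\<lambda>i. k i \<omega>) ?J))"
    proof (rule indep_var_compose)
      show "(\<lambda>s. H s j) \<in> borel_measurable (?P ?I)"
        by (subst count_space_PiM_finite) auto
      show "(\<lambda>s. indicator {j} (s (Suc t)) :: real) \<in> borel_measurable (?P ?J)"
        by (subst count_space_PiM_finite) auto
    qed
    then show ?thesis
      by (simp add: comp_def H Z_def[abs_def] Y_def[abs_def] del: One_nat_def)
  qed
  have ZY: "integrable M (\<lambda>\<omega>. Z j \<omega> * Y j \<omega>)"
      "expectation (\<lambda>\<omega>. Z j \<omega> * Y j \<omega>) = expectation (Z j) * expectation (Y j)" for j
    using indep_var_integrable[OF ind Z_int Y_int] indep_var_lebesgue_integral[OF ind Z_int Y_int]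
    by auto
  have "AE \<omega> in M. H (\<lambda>i. k i \<omega>) (k (Suc t) \<omega>) = (\<Sum>j=1..K. Z j \<omega> * Y j \<omega>)"
  proof -
    have "AE \<omega> in M. k (Suc t) \<omega> \<in> {1..K}"
      using t by (intro AE_index_in_range) simp
    then show ?thesis
      by (rule eventually_mono)
        (auto simp: Z_def Y_def indicator_def if_distrib[where f="(*) _"] sum.delta' cong: if_cong)
  qed
  moreover have "(\<lambda>\<omega>. H (\<lambda>i. k i \<omega>) (k (Suc t) \<omega>)) \<in> borel_measurable M"
  proof (rule borel_measurable_integrable)
    have "H (restrict s {1..Suc t}) (restrict s {1..Suc t} (Suc t)) = H s (s (Suc t))" for s
      using H[of "restrict s {1..Suc t}"] H[of s]
      by (simp add: Int_absorb1 restrict_restrict del: One_nat_def)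
    then show "integrable M (\<lambda>\<omega>. H (\<lambda>i. k i \<omega>) (k (Suc t) \<omega>))"
      using t by (intro integrable_history[where t="Suc t" and F="\<lambda>s. H s (s (Suc t))"]) auto
  qed
  ultimately have "expectation (\<lambda>\<omega>. H (\<lambda>i. k i \<omega>) (k (Suc t) \<omega>))
      = expectation (\<lambda>\<omega>. \<Sum>j=1..K. Z j \<omega> * Y j \<omega>)"
    using ZY(1) by (intro integral_cong_AE) auto
  also have "\<dots> = (\<Sum>j=1..K. expectation (Z j) * expectation (Y j))"
    using ZY by (subst Bochner_Integration.integral_sum) auto
  also have "\<dots> = (\<Sum>j=1..K. expectation (Z j) * (1 / K))"
    using t by (intro sum.cong refl) (simp add: Y_def[abs_def] prob_index_eq)
  also have "\<dots> = expectation (\<lambda>\<omega>. (\<Sum>j=1..K. Z j \<omega>) / K)"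
    using Z_int by (simp add: sum_divide_distrib)
  finally show ?thesis
    by (simp add: Z_def)
qed

end

end

section \<open>Convergence of AGS-SGD\<close>


theorem theorem4p1:
  fixes K T :: nat
    and fs :: "nat \<Rightarrow> real ^ 'n \<Rightarrow> real"
    and f :: "real ^ 'n \<Rightarrow> real"
    and L lam fstar :: real
    and S :: "nat \<Rightarrow> real ^ 'n ^ 'n"
    and eta :: "nat \<Rightarrow> real"
    and x0 :: "real ^ 'n"
    and M :: "'w measure"
    and k :: "nat \<Rightarrow> 'w \<Rightarrow> nat"
    and B :: "real ^ 'n ^ 'n \<Rightarrow> real ^ 'n ^ 'n \<Rightarrow> real"
  assumes K: "K \<ge> 1"
    and fs_diff: "\<And>j x. j \<in> {1..K} \<Longrightarrow> fs j differentiable (at x)"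
    and f_smooth: "L_smooth L f"
    and fstar_attained: "\<exists>x. f x = fstar"
    and fstar_le: "\<And>x. fstar \<le> f x"
    and unbiased: "\<And>x. measure_pmf.expectation (pmf_of_set {1..K}) (\<lambda>j. fs j x) = f x"
    and unbiased_grad:
      "\<And>x. measure_pmf.expectation (pmf_of_set {1..K}) (\<lambda>j. grad (fs j) x) = grad f x"
    and lam: "lam \<ge> 0"
    and grad_bound:
      "\<And>x. measure_pmf.expectation (pmf_of_set {1..K}) (\<lambda>j. (norm (grad (fs j) x))\<^sup>2) \<le> lam\<^sup>2"
    and T: "T \<ge> 1"
    and S_sym_inv: "\<And>t. t \<in> {1..T} \<Longrightarrow> sym_invertible (S t)"
    and S_0: "S 0 = 0"
    and eta_pos: "\<And>t. t \<in> {1..T} \<Longrightarrow> eta t > 0"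
    and M: "prob_space M"
    and k_indep: "prob_space.indep_vars M (\<lambda>_. count_space UNIV) k {1..T}"
    and k_unif: "\<And>t. t \<in> {1..T} \<Longrightarrow>
      distr M (count_space UNIV) (k t) = measure_pmf (pmf_of_set {1..K})"
    and B: "\<And>P Q x. P = 0 \<or> sym_invertible P \<Longrightarrow> Q = 0 \<or> sym_invertible Q \<Longrightarrow>
      \<bar>gauss_smooth P f x - gauss_smooth Q f x\<bar> \<le> B P Q"
  shows "\<exists>\<nu>\<in>{0..T-1}.
    prob_space.expectation M
      (\<lambda>\<omega>. (norm (grad (gauss_smooth (S (\<nu> + 1)) f) (ags_sgd fs S eta x0 (\<lambda>t. k t \<omega>) \<nu>)))\<^sup>2)
    \<le> (f x0 - fstar) / (\<Sum>t=1..T. eta t)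
      + L * lam\<^sup>2 * (\<Sum>t=1..T. (eta t)\<^sup>2) / (\<Sum>t=1..T. eta t)
      + L ^ 3 * (3 + real CARD('n)) ^ 3 / 8
        * ((\<Sum>t=1..T. mat_norm (S t) ^ 4 * (mat_norm (matrix_inv (S t)))\<^sup>2 * (eta t)\<^sup>2)
            / (\<Sum>t=1..T. eta t))
      + (\<Sum>t=1..T. B (S t) (S (t - 1))) / (\<Sum>t=1..T. eta t)"
proof -
  interpret prob_space M by (rule M)
  define X where "X t s = ags_sgd fs S eta x0 s t" for t s
  define Xk where "Xk t \<omega> = X t (\<lambda>i. k i \<omega>)" for t \<omega>
  define F where "F t = gauss_smooth (S t) f" for t
  define a where "a t = expectation (\<lambda>\<omega>. F t (Xk t \<omega>))" for t
  define e where "e t = expectation (\<lambda>\<omega>. (norm (grad (F (Suc t)) (Xk t \<omega>)))\<^sup>2)" for t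
  note L = L_smooth_nonneg[OF f_smooth]
  have pmf_sum: "(\<Sum>j=1..K. h j) = real K *\<^sub>R measure_pmf.expectation (pmf_of_set {1..K}) h"
    for h :: "nat \<Rightarrow> 'b::{banach, second_countable_topology}"
    using K by (subst integral_measure_pmf[of "{1..K}"]) (auto simp: scaleR_sum_right)
  have sum_grad: "(\<Sum>j=1..K. grad (fs j) x) = real K *\<^sub>R grad f x" for x
    by (simp only: pmf_sum unbiased_grad)
  have sum_sq: "(\<Sum>j=1..K. (norm (grad (fs j) x))\<^sup>2) \<le> real K * lam\<^sup>2" for x
    unfolding pmf_sum using grad_bound[of x] by (simp add: mult_left_mono)
  note f_diff = L_smooth_differentiable[OF f_smooth]
  note lower = gauss_smooth_lower_bound[OF L_smooth_differentiable[OF f_smooth] norm_grad_mean_le[OF K fs_diff f_smooth sum_grad sum_sq] fstar_le]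
  note step = mean_step_le[OF K fs_diff f_smooth sum_grad sum_sq]
  have X_hist: "X t (restrict s {1..t}) = X t s" for t s
    unfolding X_def by (rule ags_sgd_cong) simp
  have int: "integrable M (\<lambda>\<omega>. h (Xk t \<omega>) :: real)" if "t \<le> T" for h t
    unfolding Xk_def
    by (rule integrable_history[OF K k_indep k_unif that, where F="\<lambda>s. h (X t s)"])
      (simp_all add: X_hist del: One_nat_def)
  have S_ok: "S t = 0 \<or> sym_invertible (S t)" if "t \<le> T" for t
    using that S_0 S_sym_inv[of t] by (cases "t = 0") auto

  \<comment> \<open>The smoothing level of the left-hand side is \<open>t + 1\<close> and that of the right-hand side is \<open>t\<close>, so that
    consecutive inequalities telescope; the term with \<open>B\<close> pays for the change of level.\<close>
  have descent: "a (Suc t) + eta (Suc t) * e t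
      \<le> a t + B (S (Suc t)) (S t) + L / 2 * (eta (Suc t))\<^sup>2 * lam\<^sup>2" if t: "t < T" for t
  proof -
    define H where "H s j = F (Suc t) (X t s - eta (Suc t) *\<^sub>R grad (gauss_smooth (S (Suc t)) (fs j)) (X t s))"
      for s j
    have "a (Suc t) = expectation (\<lambda>\<omega>. H (\<lambda>i. k i \<omega>) (k (Suc t) \<omega>))"
      by (simp add: a_def H_def Xk_def X_def)
    also have "\<dots> = expectation (\<lambda>\<omega>. (\<Sum>j=1..K. H (\<lambda>i. k i \<omega>) j) / K)"
      by (rule expectation_next_index[OF K k_indep k_unif t]) (simp_all only: H_def X_hist)
    also have "\<dots> \<le> expectation (\<lambda>\<omega>. F t (Xk t \<omega>) + B (S (Suc t)) (S t)
        - eta (Suc t) * (norm (grad (F (Suc t)) (Xk t \<omega>)))\<^sup>2 + L / 2 * (eta (Suc t))\<^sup>2 * lam\<^sup>2)"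
    proof (rule integral_mono)
      show "integrable M (\<lambda>\<omega>. (\<Sum>j=1..K. H (\<lambda>i. k i \<omega>) j) / K)"
        using int[OF less_imp_le[OF t]] unfolding H_def Xk_def
        by (intro Bochner_Integration.integrable_divide Bochner_Integration.integrable_sum)
      fix \<omega>
      have "F (Suc t) (Xk t \<omega>) \<le> F t (Xk t \<omega>) + B (S (Suc t)) (S t)"
        using B[OF S_ok[of "Suc t"] S_ok[of t], of "Xk t \<omega>"] t by (simp add: F_def)
      then show "(\<Sum>j=1..K. H (\<lambda>i. k i \<omega>) j) / K \<le> F t (Xk t \<omega>) + B (S (Suc t)) (S t)
          - eta (Suc t) * (norm (grad (F (Suc t)) (Xk t \<omega>)))\<^sup>2 + L / 2 * (eta (Suc t))\<^sup>2 * lam\<^sup>2"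
        using step[of "S (Suc t)" "Xk t \<omega>" "eta (Suc t)"] by (simp add: H_def F_def Xk_def)
    qed (use t int[OF less_imp_le[OF t]] in auto)
    also have "\<dots> = a t + B (S (Suc t)) (S t) - eta (Suc t) * e t + L / 2 * (eta (Suc t))\<^sup>2 * lam\<^sup>2"
      using int[OF less_imp_le[OF t], of "F t"]
        int[OF less_imp_le[OF t], of "\<lambda>x. (norm (grad (F (Suc t)) x))\<^sup>2"]
      by (simp add: a_def e_def prob_space)
    finally show ?thesis by simp
  qed
  have telescope: "a n + (\<Sum>t=1..n. eta t * e (t - 1))
      \<le> f x0 + (\<Sum>t=1..n. B (S t) (S (t - 1))) + L / 2 * lam\<^sup>2 * (\<Sum>t=1..n. (eta t)\<^sup>2)" if "n \<le> T" for n
    using that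
  proof (induction n)
    case 0
    have "a 0 = f x0"
      using gauss_smooth_zero[OF f_diff] by (simp add: a_def F_def S_0 Xk_def X_def prob_space)
    then show ?case by simp
  next
    case (Suc n)
    then show ?case
      using descent[of n] by (simp add: algebra_simps)
  qed
  have "fstar \<le> a T"
    unfolding a_def F_def
    by (rule integral_ge_const) (use int[of T] lower in auto)
  then have sum_le: "(\<Sum>t=1..T. eta t * e (t - 1))
      \<le> f x0 - fstar + (\<Sum>t=1..T. B (S t) (S (t - 1))) + L / 2 * lam\<^sup>2 * (\<Sum>t=1..T. (eta t)\<^sup>2)"
    using telescope[of T] by simp

  define E where "E = (\<Sum>t=1..T. eta t)"
  define V where "V = L ^ 3 * (3 + real CARD('n)) ^ 3 / 8
        * (\<Sum>t=1..T. mat_norm (S t) ^ 4 * (mat_norm (matrix_inv (S t)))\<^sup>2 * (eta t)\<^sup>2)"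
  define R where "R = f x0 - fstar + L * lam\<^sup>2 * (\<Sum>t=1..T. (eta t)\<^sup>2) + V + (\<Sum>t=1..T. B (S t) (S (t - 1)))"
  have E: "E > 0"
    unfolding E_def using T eta_pos by (intro sum_pos) auto
  \<comment> \<open>The passage to \<open>R\<close> adds the nonnegative \<open>V\<close> and doubles the term with \<open>\<lambda>\<^sup>2\<close>.\<close>
  have "V \<ge> 0"
    unfolding V_def using L by (intro mult_nonneg_nonneg divide_nonneg_nonneg sum_nonneg) auto
  moreover have "L / 2 * lam\<^sup>2 * (\<Sum>t=1..T. (eta t)\<^sup>2) \<le> L * lam\<^sup>2 * (\<Sum>t=1..T. (eta t)\<^sup>2)"
    using L by (intro mult_right_mono sum_nonneg) auto
  ultimately have le_R: "(\<Sum>t=1..T. eta t * e (t - 1)) \<le> R"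
    using sum_le by (simp add: R_def)
  have "\<exists>t\<in>{1..T}. e (t - 1) \<le> R / E"
  proof (rule ccontr)
    assume "\<not> ?thesis"
    then have "R / E < e (t - 1)" if "t \<in> {1..T}" for t
      using that by (meson not_le)
    then have "(\<Sum>t=1..T. eta t * (R / E)) < (\<Sum>t=1..T. eta t * e (t - 1))"
      using T eta_pos by (intro sum_strict_mono mult_strict_left_mono) auto
    also have "(\<Sum>t=1..T. eta t * (R / E)) = R"
      using E by (simp add: E_def flip: sum_distrib_right sum_divide_distrib)
    finally show False
      using le_R by simp
  qed
  then obtain t where t: "t \<in> {1..T}" "e (t - 1) \<le> R / E"
    by blast
  show ?thesis
  proof (rule bexI[of _ "t - 1"])
    have "R / E = (f x0 - fstar) / E + L * lam\<^sup>2 * (\<Sum>t=1..T. (eta t)\<^sup>2) / E + V / E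
        + (\<Sum>t=1..T. B (S t) (S (t - 1))) / E"
      by (simp add: R_def add_divide_distrib)
    then show "expectation
      (\<lambda>\<omega>. (norm (grad (gauss_smooth (S (t - 1 + 1)) f) (ags_sgd fs S eta x0 (\<lambda>t. k t \<omega>) (t - 1))))\<^sup>2)
      \<le> (f x0 - fstar) / (\<Sum>t=1..T. eta t)
      + L * lam\<^sup>2 * (\<Sum>t=1..T. (eta t)\<^sup>2) / (\<Sum>t=1..T. eta t)
      + L ^ 3 * (3 + real CARD('n)) ^ 3 / 8
        * ((\<Sum>t=1..T. mat_norm (S t) ^ 4 * (mat_norm (matrix_inv (S t)))\<^sup>2 * (eta t)\<^sup>2)
            / (\<Sum>t=1..T. eta t))
      + (\<Sum>t=1..T. B (S t) (S (t - 1))) / (\<Sum>t=1..T. eta t)"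
      using t(2) by (simp add: e_def F_def Xk_def X_def V_def E_def)
    show "t - 1 \<in> {0..T-1}"
      using t(1) by auto
  qed
qed

end
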